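(* Let $\Pi_{42}$ be the map on $\mathbb{N}=\{1,2,3,\dots\}$ produced by the following procedure, with $L(m)=R(m)=\lfloor (m+1)/2\rfloor$. At step $1$ set $\Pi_{42}(1)=1$. For $m=2,3,4,\dots$ in turn, at step $m$: if $\Pi_{42}(m-L(m))$ has not been assigned at an earlier step, set $\Pi_{42}(m-L(m))=m$; otherwise set $\Pi_{42}(m+R(m))=m$. Let $\sigma$ be the morphism on $\{2,3,4,5\}^*$ given by $\sigma(2)=232$, $\sigma(3)=234$, $\sigma(4)=234$, $\sigma(5)=524$, and let $s=s_1s_2s_3\dots=524232234\dots$ be its fixed point starting with $5$. Then for all $n>1$: $s_n=2$ iff $\Pi_{42}(n)$ has type (II); $s_n=3$ iff $\Pi_{42}(n)$ has type (III); $s_n=4$ iff $\Pi_{42}(n)$ has type (IV).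
   Context: The procedure assigns a value $\Pi_{42}(n)$ to every $n\in\mathbb{N}$. Types: $\Pi_{42}(n)$ has type (II) if $\Pi_{42}(n)>n$ and $\Pi_{42}(n)=2n$; type (III) if $\Pi_{42}(n)<n$ and $\Pi_{42}(n)=(2n-1)/3$; type (IV) if $\Pi_{42}(n)<n$ and $\Pi_{42}(n)=2n/3$. *)

theory Defs
  imports Complex_Main "HOL-Library.Stream"
begin

text \<open>
  The state after step \<open>m\<close>, for general \<open>L\<close> and \<open>R\<close>, is the partial map of the assignments
  made so far. Steps are numbered from 1, so the state after step 0 is empty.
\<close>

fun state_after :: "(nat \<Rightarrow> nat) \<Rightarrow> (nat \<Rightarrow> nat) \<Rightarrow> nat \<Rightarrow> (nat \<rightharpoonup> nat)" where
  "state_after L R 0 = Map.empty"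
| "state_after L R (Suc 0) = [1 \<mapsto> 1]"
| "state_after L R (Suc (Suc k)) =
     (let m = Suc (Suc k); A = state_after L R (Suc k) in
        if A (m - L m) = None then A(m - L m \<mapsto> m) else A(m + R m \<mapsto> m))"

definition half42 :: "nat \<Rightarrow> nat" where
  "half42 m = (m + 1) div 2"

abbreviation state42 :: "nat \<Rightarrow> (nat \<rightharpoonup> nat)" where
  "state42 \<equiv> state_after half42 half42"

definition pi42 :: "nat \<Rightarrow> nat" where
  "pi42 n = (THE v. \<exists>m. state42 m n = Some v)"

text \<open>
  The map is well defined: an assignment is never overwritten, and every positive \<open>n\<close>
  is assigned a value, at step \<open>2 * n\<close> at the latest.
\<close>

lemma state42_Suc:
  assumes "m \<ge> 1"
  shows "state42 (Suc m) =
    (let j = Suc m - half42 (Suc m) in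
      if state42 m j = None then (state42 m)(j \<mapsto> Suc m)
      else (state42 m)(Suc m + half42 (Suc m) \<mapsto> Suc m))"
  using assms by (cases m) (simp_all add: Let_def)

lemma state42_origin:
  "state42 m j = Some v \<Longrightarrow> v \<le> m \<and> j \<le> v + half42 v"
proof (induction m arbitrary: j v)
  case 0
  then show ?case by simp
next
  case (Suc m)
  show ?case
  proof (cases "m = 0")
    case True
    with Suc.prems show ?thesis by (auto split: if_splits)
  next
    case False
    then have "m \<ge> 1" by simp
    with Suc.prems have "state42 m j = Some v \<or> (v = Suc m \<and> j \<le> Suc m + half42 (Suc m))"
      by (auto simp: state42_Suc Let_def split: if_splits)
    with Suc.IH[of j v] show ?thesis by auto
  qed
qed

lemma state42_not_overwritten:
  assumes "state42 m j = Some v" and "m \<le> k"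
  shows "state42 k j = Some v"
  using assms(2)
proof (induction k rule: dec_induct)
  case base
  show ?case by (fact assms(1))
next
  case (step k)
  have "v \<le> k" and "j \<le> v + half42 v"
    using state42_origin[OF step.IH] by auto
  moreover have "half42 v \<le> half42 (Suc k)"
    using \<open>v \<le> k\<close> unfolding half42_def by (intro div_le_mono) simp
  ultimately have "j \<noteq> Suc k + half42 (Suc k)" by linarith
  moreover have "k \<ge> 1"
    using step.IH by (cases k) auto
  ultimately show ?case
    using step.IH by (auto simp: state42_Suc Let_def)
qed

lemma state42_assigned:
  assumes "n \<ge> 1"
  shows "\<exists>v. state42 (2 * n) n = Some v"
proof -
  obtain k where k: "2 * n = Suc k" "k \<ge> 1"
    using assms by (cases "2 * n") auto
  have "Suc k - half42 (Suc k) = n"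
    unfolding k(1)[symmetric] half42_def by simp
  then show ?thesis
    unfolding k(1) using k(2) by (auto simp: state42_Suc Let_def)
qed

lemma pi42_unique:
  assumes "n \<ge> 1"
  shows "\<exists>!v. \<exists>m. state42 m n = Some v"
proof -
  obtain v where v: "state42 (2 * n) n = Some v"
    using state42_assigned[OF assms] by blast
  show ?thesis
  proof (rule ex1I[of _ v])
    show "\<exists>m. state42 m n = Some v" using v by blast
  next
    fix w assume "\<exists>m. state42 m n = Some w"
    then obtain m where "state42 m n = Some w" by blast
    then have "state42 (max m (2 * n)) n = Some w"
      by (rule state42_not_overwritten) simp
    moreover have "state42 (max m (2 * n)) n = Some v"
      using v by (rule state42_not_overwritten) simp
    ultimately show "w = v" by simp
  qed
qed

definition type_II :: "nat \<Rightarrow> bool" where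
  "type_II n \<longleftrightarrow> pi42 n > n \<and> real (pi42 n) = 2 * real n"

definition type_III :: "nat \<Rightarrow> bool" where
  "type_III n \<longleftrightarrow> pi42 n < n \<and> real (pi42 n) = (2 * real n - 1) / 3"

definition type_IV :: "nat \<Rightarrow> bool" where
  "type_IV n \<longleftrightarrow> pi42 n < n \<and> real (pi42 n) = 2 * real n / 3"

text \<open>The letters 2, 3, 4, 5; the morphism is given by its values on letters.\<close>

datatype letter = Two | Three | Four | Five

fun sigma :: "letter \<Rightarrow> letter list" where
  "sigma Two = [Two, Three, Two]"
| "sigma Three = [Two, Three, Four]"
| "sigma Four = [Two, Three, Four]"
| "sigma Five = [Five, Two, Four]"

definition sigma_stream :: "letter stream \<Rightarrow> letter stream" where
  "sigma_stream w = flat (smap sigma w)"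

definition s_stream :: "letter stream" where
  "s_stream = (THE w. sigma_stream w = w \<and> shd w = Five)"

text \<open>Indexing of \<open>s\<close> starts at 1, while that of streams starts at 0.\<close>

definition s :: "nat \<Rightarrow> letter" where
  "s n = s_stream !! (n - 1)"

lemma length_sigma: "length (sigma a) = 3"
  by (cases a) simp_all

lemma sigma_stream_snth: "sigma_stream w !! n = sigma (w !! (n div 3)) ! (n mod 3)"
proof (induction n arbitrary: w rule: less_induct)
  case (less n)
  have ne: "\<forall>xs \<in> sset (smap sigma w). xs \<noteq> []"
    using length_sigma by (auto simp: stream.set_map) (metis list.size(3) zero_neq_numeral)
  show ?case
  proof (cases "n < 3")
    case True
    then show ?thesis
      unfolding sigma_stream_def flat_snth[OF ne] by (simp add: length_sigma)
  next
    case False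
    then have "sigma_stream w !! n = sigma_stream (stl w) !! (n - 3)"
      unfolding sigma_stream_def flat_snth[OF ne] by (simp add: length_sigma)
    also have "\<dots> = sigma (stl w !! ((n - 3) div 3)) ! ((n - 3) mod 3)"
      using False by (intro less.IH) simp
    also have "\<dots> = sigma (w !! (n div 3)) ! (n mod 3)"
      using False by (simp add: le_div_geq le_mod_geq)
    finally show ?thesis .
  qed
qed

fun fixpoint_letter :: "nat \<Rightarrow> letter" where
  "fixpoint_letter n =
     (if n = 0 then Five else sigma (fixpoint_letter (n div 3)) ! (n mod 3))"

declare fixpoint_letter.simps [simp del]

lemma s_stream_unique: "\<exists>!w. sigma_stream w = w \<and> shd w = Five"
proof (rule ex_ex1I)
  define w where "w = smap fixpoint_letter nats"
  have w: "w !! n = fixpoint_letter n" for n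
    by (simp add: w_def)
  have "sigma_stream w !! n = w !! n" for n
    unfolding sigma_stream_snth w
    by (cases "n = 0") (simp_all add: fixpoint_letter.simps[of n] fixpoint_letter.simps[of 0])
  then have "sigma_stream w = w"
    by (metis stream_smap_nats ext)
  moreover have "shd w = Five"
    using w[of 0] by (simp add: fixpoint_letter.simps[of 0])
  ultimately show "\<exists>w. sigma_stream w = w \<and> shd w = Five" by blast
next
  have *: "w !! n = fixpoint_letter n" if w: "sigma_stream w = w \<and> shd w = Five" for w n
  proof (induction n rule: less_induct)
    case (less n)
    show ?case
    proof (cases "n = 0")
      case True
      then show ?thesis using w by (simp add: fixpoint_letter.simps[of 0])
    next
      case False
      then have "w !! n = sigma (w !! (n div 3)) ! (n mod 3)"
        using w sigma_stream_snth[of w n] by simp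
      with False less.IH[of "n div 3"] show ?thesis
        by (simp add: fixpoint_letter.simps[of n])
    qed
  qed
  fix v w
  assume "sigma_stream v = v \<and> shd v = Five" and "sigma_stream w = w \<and> shd w = Five"
  then have "v !! n = w !! n" for n
    using * by simp
  then show "v = w"
    by (metis stream_smap_nats ext)
qed

end

theory Submission
  imports Defs
begin

text \<open>
  For \<open>k \<ge> 1\<close>, steps \<open>2 * k\<close> and \<open>2 * k + 1\<close> both try position \<open>k\<close>, which is therefore always taken at the
  second attempt: step \<open>2 * k + 1\<close> assigns position \<open>3 * k + 2\<close>, while step \<open>2 * k\<close> assigns \<open>k\<close>
  if it is still free and \<open>3 * k\<close> otherwise. Hence \<open>3 * k\<close> has type (II) exactly when \<open>k\<close> has,
  the numbers \<open>3 * k + 1\<close> have type (II), and the numbers \<open>3 * k + 2\<close> have type (III). This is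
  the recursion satisfied by the letters of the fixed point.
\<close>

lemma s_one: "s 1 = Five"
  using theI'[OF s_stream_unique] by (simp add: s_def s_stream_def)

lemma s_rec:
  assumes "r < 3"
  shows "s (3 * j + r + 1) = sigma (s (Suc j)) ! r"
  using theI'[OF s_stream_unique] sigma_stream_snth[of s_stream "3 * j + r"] assms
  by (simp add: s_def s_stream_def)

text \<open>The only occurrence of \<open>Five\<close> in an image of \<open>sigma\<close> is the
  first letter of \<open>sigma Five\<close>. A \<open>Five\<close> at \<open>n\<close> thus forces
  one at the smaller index \<open>Suc j\<close> of its block, and induction leads back to the first
  block.\<close>

lemma s_eq_Five_iff:
  assumes "n \<ge> 1"
  shows "s n = Five \<longleftrightarrow> n = 1"
  using assms
proof (induction n rule: less_induct)
  case (less n)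
  show ?case
  proof (cases "n = 1")
    case True
    then show ?thesis using s_one by simp
  next
    case False
    define j r where "j = (n - 1) div 3" and "r = (n - 1) mod 3"
    have n: "n = 3 * j + r + 1" and r: "r < 3"
      using less.prems by (auto simp: j_def r_def)
    have IH: "s (Suc j) = Five \<longleftrightarrow> j = 0"
      using less.IH[of "Suc j"] n False by force
    have "r = 0 \<or> r = 1 \<or> r = 2" using r by auto
    then have "sigma (s (Suc j)) ! r \<noteq> Five"
      using IH n False by (cases "s (Suc j)") auto
    then show ?thesis
      using False s_rec[OF r, of j] n by simp
  qed
qed

text \<open>Beyond the first block only \<open>Two\<close>, \<open>Three\<close> and
  \<open>Four\<close> are expanded, and their images all begin with \<open>Two\<close>,
  \<open>Three\<close>.\<close>

lemma s_mod_1: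
  assumes "k \<ge> 1"
  shows "s (3 * k + 1) = Two"
  using s_rec[of 0 k] s_eq_Five_iff[of "Suc k"] assms
  by (cases "s (Suc k)") auto

lemma s_two: "s 2 = Two"
  using s_rec[of 1 0] s_one by (simp add: numeral_2_eq_2)

lemma s_mod_2:
  assumes "k \<ge> 1"
  shows "s (3 * k + 2) = Three"
  using s_rec[of 1 k] s_eq_Five_iff[of "Suc k"] assms
  by (cases "s (Suc k)") auto

text \<open>The last letter of a block is the only one that distinguishes \<open>sigma Two\<close>
  from \<open>sigma Three\<close> and \<open>sigma Four\<close>; \<open>sigma Five\<close> also ends
  in \<open>Four\<close>, which covers \<open>k = 1\<close>.\<close>

lemma s_mod_0:
  assumes "k \<ge> 1"
  shows "s (3 * k) = (if s k = Two then Two else Four)"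
proof -
  obtain j where k: "k = Suc j" using assms by (cases k) auto
  then have "3 * k = 3 * j + 2 + 1" by simp
  then have "s (3 * k) = sigma (s k) ! 2"
    using s_rec[of 2 j] k by (simp only:)
  then show ?thesis by (cases "s k") auto
qed

text \<open>The value of \<open>pi42 n\<close> predicted by the letter. \<open>Three\<close> occurs
  only at \<open>n = 3 * k + 2\<close> and \<open>Four\<close> only at \<open>n = 3 * k\<close>, so
  the quotients by 3 in types (III) and (IV) become \<open>2 * k + 1\<close> and
  \<open>2 * k\<close>.\<close>

definition letter_value :: "nat \<Rightarrow> nat" where
  "letter_value n = (case s n of Two \<Rightarrow> 2 * n | Three \<Rightarrow> 2 * (n div 3) + 1
     | Four \<Rightarrow> 2 * (n div 3) | Five \<Rightarrow> 1)"

lemma letter_value_cases: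
  assumes "n \<ge> 1"
  obtains "n = 1" "s n = Five" "letter_value n = 1"
    | "s n = Two" "letter_value n = 2 * n"
    | k where "k \<ge> 1" "n = 3 * k + 2" "s n = Three" "letter_value n = 2 * k + 1"
    | k where "k \<ge> 1" "n = 3 * k" "s k \<noteq> Two" "s n = Four" "letter_value n = 2 * k"
proof -
  define k where "k = n div 3"
  consider "n = 1" | "n = 2" | "k \<ge> 1" "n = 3 * k" | "k \<ge> 1" "n = 3 * k + 1"
    | "k \<ge> 1" "n = 3 * k + 2"
    using assms unfolding k_def by linarith
  then show thesis
  proof cases
    case 1
    then show ?thesis using that(1) s_one by (simp add: letter_value_def)
  next
    case 2
    then show ?thesis using that(2) s_two by (simp add: letter_value_def)
  next
    case 3
    then show ?thesis
      using that(2) that(4)[of k] s_mod_0[of k]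
      by (cases "s k = Two") (simp_all add: letter_value_def)
  next
    case 4
    then show ?thesis using that(2) s_mod_1[of k] by (simp add: letter_value_def)
  next
    case 5
    then show ?thesis using that(3)[of k] s_mod_2[of k] by (simp add: letter_value_def)
  qed
qed

lemma letter_value_less_iff:
  assumes "n \<ge> 1"
  shows "letter_value n < 2 * n \<longleftrightarrow> s n \<noteq> Two"
  using assms by (cases rule: letter_value_cases) auto

lemma letter_value_le:
  assumes "n \<ge> 1"
  shows "letter_value n \<le> 2 * n"
  using assms by (cases rule: letter_value_cases) auto

lemma letter_value_ge_1:
  assumes "n \<ge> 1"
  shows "letter_value n \<ge> 1"
  using assms by (cases rule: letter_value_cases) (use assms in auto)

lemma letter_value_eq_1_iff:
  assumes "n \<ge> 1"
  shows "letter_value n = 1 \<longleftrightarrow> n = 1"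
  using assms by (cases rule: letter_value_cases) (use s_one in auto)

text \<open>Inverts \<open>letter_value\<close> on even values, to be matched with the position
  filled at step \<open>2 * k\<close>; the odd values follow in the same way.\<close>

lemma letter_value_eq_even_iff:
  assumes "n \<ge> 1" and "k \<ge> 1"
  shows "letter_value n = 2 * k \<longleftrightarrow> n = (if s k = Two then k else 3 * k)"
  using assms(1)
proof (cases rule: letter_value_cases)
  case 1
  then show ?thesis using assms(2) by auto
next
  case 2
  \<comment> \<open>If \<open>s k \<noteq> Two\<close>, position \<open>3 * k\<close> carries
    \<open>Four\<close>, so it cannot be the present \<open>n\<close>.\<close>
  then show ?thesis using assms(2) s_mod_0[of k] by auto
next
  case (3 j)
  have "3 * j + 2 \<noteq> 3 * k" and "2 * j + 1 \<noteq> 2 * k" by presburger+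
  with 3 show ?thesis by auto
next
  case (4 j)
  then show ?thesis by auto
qed

lemma letter_value_eq_odd_iff:
  assumes "n \<ge> 1" and "k \<ge> 1"
  shows "letter_value n = 2 * k + 1 \<longleftrightarrow> n = 3 * k + 2"
  using assms(1)
proof (cases rule: letter_value_cases)
  case 1
  then show ?thesis using assms(2) by auto
next
  case 2
  have "2 * n \<noteq> 2 * k + 1" by presburger
  with 2 show ?thesis using s_mod_2[OF assms(2)] by auto
next
  case (3 j)
  then show ?thesis by auto
next
  case (4 j)
  have "3 * j \<noteq> 3 * k + 2" and "2 * j \<noteq> 2 * k + 1" by presburger+
  with 4 show ?thesis by auto
qed

text \<open>Invariant of the procedure: each step fills the one position whose predicted value is
  the step number.\<close>

lemma state42_eq:
  "state42 m n = (if n \<ge> 1 \<and> letter_value n \<le> m then Some (letter_value n) else None)"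
proof (induction m arbitrary: n)
  case 0
  then show ?case using letter_value_ge_1[of n] by auto
next
  case (Suc m)
  \<comment> \<open>Common to all cases of the induction: it suffices to exhibit the position
    \<open>t\<close> filled at step \<open>Suc m\<close> and to show that it alone has predicted
    value \<open>Suc m\<close>.\<close>
  have step: ?case
    if upd: "state42 (Suc m) n = (if n = t then Some (Suc m) else state42 m n)"
      and t: "\<And>i. i \<ge> 1 \<Longrightarrow> letter_value i = Suc m \<longleftrightarrow> i = t" and "t \<ge> 1" for t
  proof (cases "n = t")
    case True
    then show ?thesis using upd t[of t] \<open>t \<ge> 1\<close> by simp
  next
    case False
    then show ?thesis using upd t[of n] Suc.IH[of n] by (simp add: le_Suc_eq)
  qed
  define k where "k = Suc m div 2"
  consider "m = 0" | "k \<ge> 1" "Suc m = 2 * k" | "k \<ge> 1" "Suc m = 2 * k + 1"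
    unfolding k_def by linarith
  then show ?case
  proof cases
    case 1
    then show ?thesis
      using letter_value_eq_1_iff by (intro step[of 1]) auto
  next
    case 2
    then have "m \<ge> 1" by linarith
    have half: "half42 (Suc m) = k" "Suc m - k = k"
      unfolding half42_def using 2 by auto
    have tgt: "Suc m + k = 3 * k" using 2 by simp
    \<comment> \<open>Here \<open>m = 2 * k - 1\<close>, so by induction \<open>k\<close> is taken
      exactly when \<open>letter_value k < 2 * k\<close>.\<close>
    have free: "state42 m k = None \<longleftrightarrow> s k = Two"
      using Suc.IH[of k] letter_value_less_iff[of k] 2 by auto
    show ?thesis
    proof (rule step[of "if s k = Two then k else 3 * k"])
      show "state42 (Suc m) n =
          (if n = (if s k = Two then k else 3 * k) then Some (Suc m) else state42 m n)"
        using free unfolding state42_Suc[OF \<open>m \<ge> 1\<close>] half tgt Let_def by auto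
    next
      fix i :: nat assume "i \<ge> 1"
      then show "letter_value i = Suc m \<longleftrightarrow> i = (if s k = Two then k else 3 * k)"
        using letter_value_eq_even_iff[of i k] 2 by simp
    next
      show "(if s k = Two then k else 3 * k) \<ge> 1" using 2 by simp
    qed
  next
    case 3
    then have "m \<ge> 1" by linarith
    have half: "half42 (Suc m) = k + 1" "Suc m - (k + 1) = k"
      unfolding half42_def using 3 by auto
    \<comment> \<open>Here \<open>m = 2 * k\<close>, which bounds every possible
      \<open>letter_value k\<close>.\<close>
    have taken: "state42 m k \<noteq> None"
      using Suc.IH[of k] letter_value_le[of k] 3 by auto
    have tgt: "Suc m + (k + 1) = 3 * k + 2" using 3 by simp
    show ?thesis
    proof (rule step[of "3 * k + 2"])
      show "state42 (Suc m) n = (if n = 3 * k + 2 then Some (Suc m) else state42 m n)"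
        using taken unfolding state42_Suc[OF \<open>m \<ge> 1\<close>] half tgt Let_def by auto
    next
      fix i :: nat assume "i \<ge> 1"
      then show "letter_value i = Suc m \<longleftrightarrow> i = 3 * k + 2"
        using letter_value_eq_odd_iff[of i k] 3 by simp
    qed simp
  qed
qed

lemma pi42_eq_letter_value:
  assumes "n \<ge> 1"
  shows "pi42 n = letter_value n"
  unfolding pi42_def using assms by (intro the_equality) (auto simp: state42_eq split: if_splits)

theorem theorem7:
  fixes n :: nat
  assumes "n > 1"
  shows "(s n = Two \<longleftrightarrow> type_II n) \<and> (s n = Three \<longleftrightarrow> type_III n) \<and> (s n = Four \<longleftrightarrow> type_IV n)"
proof -
  have n: "n \<ge> 1" using assms by simp
  note defs = type_II_def type_III_def type_IV_def
  \<comment> \<open>The letter fixes the value, and for \<open>n > 1\<close> the formulas of the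
    three types give different values, so only the matching type holds.\<close>
  from n show ?thesis
    using assms pi42_eq_letter_value[OF n]
    by (cases rule: letter_value_cases) (simp_all add: defs)
qed

end
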